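(* Let $\mathcal{R}$ be a $2$-torsion free unital ring, let $n\geq 2$, let $M_n(\mathcal{R})$ be the ring of all $n\times n$ matrices over $\mathcal{R}$ with identity matrix $\mathbf{1}$, and let $\varphi:M_n(\mathcal{R})\rightarrow M_n(\mathcal{R})$ be an additive map satisfying $$\varphi(\mathbf{a}\mathbf{b}+\mathbf{b}\mathbf{a})=\mathbf{a}\varphi(\mathbf{b})+\varphi(\mathbf{b})\mathbf{a}\qquad\text{for all }\mathbf{a},\mathbf{b}\in M_n(\mathcal{R}).$$ Then $\varphi(\mathbf{a})=\mathbf{a}\varphi(\mathbf{1})$ for all $\mathbf{a}\in M_n(\mathcal{R})$, where $\varphi(\mathbf{1})\in Z(M_n(\mathcal{R}))$.
   Context: All rings are associative (not necessarily commutative). A ring is $2$-torsion free if $2x=0$ implies $x=0$ for every element $x$. $Z(\cdot)$ denotes the centre of a ring. *)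

theory Defs
  imports "Jordan_Normal_Form.Matrix"
begin

(* The sort {ring, monoid_mult} is that of associative unital rings. Unlike ring_1 it does not
   demand 0 \<noteq> 1, so the zero ring is included. *)

definition mat_centre :: "nat \<Rightarrow> 'a :: {ring, monoid_mult} mat set" where
  "mat_centre n = {z \<in> carrier_mat n n. \<forall>a \<in> carrier_mat n n. z * a = a * z}"

(* 2x is spelled x + x, because the numeral 2 is not available at the sort {ring, monoid_mult}. *)
definition two_torsion_free :: "'a :: {ring, monoid_mult} itself \<Rightarrow> bool" where
  "two_torsion_free _ \<longleftrightarrow> (\<forall>x :: 'a. x + x = 0 \<longrightarrow> x = 0)"

end

theory Submission
  imports Defs
begin

text \<open>
  Write \<open>c = \<phi>(1)\<close> and \<open>[a, c] = ac - ca\<close>. Taking \<open>b = 1\<close> in the identity gives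
  \<open>2\<phi>(a) = ac + ca\<close>, so \<open>\<phi>\<close> is determined by \<open>c\<close>. Substituting this back into twice
  the identity, most terms cancel and what remains is \<open>b[a, c] = [a, c]b\<close>: every commutator
  with \<open>c\<close> is central (\<open>commutator_central_if_jordan_centraliser\<close>).

  In a matrix ring of size at least two this already forces \<open>c\<close> to be central
  (\<open>central_if_commutators_central\<close>), because central matrices are scalar: the off-diagonal
  entries of every \<open>[a, c]\<close> vanish. For \<open>a\<close> a diagonal matrix unit this says that \<open>c\<close> is
  diagonal, and for \<open>a = rE\<^sub>p\<^sub>q\<close> with \<open>p \<noteq> q\<close> that \<open>rc\<^sub>q\<^sub>q = c\<^sub>p\<^sub>pr\<close>.
  Finally \<open>2\<phi>(a) = ac + ca = 2ac\<close>, and 2 can be cancelled.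
\<close>

section \<open>Products with at most one nonzero summand per entry\<close>

text \<open>
  These two lemmas evaluate all products with identity matrices, diagonal matrices and matrix
  units that occur below: in each of them, one factor has at most one nonzero entry in the row or
  column involved.
\<close>

lemma index_mult_mat_single_row_entry:
  fixes A B :: "'a :: semiring_0 mat"
  assumes A: "A \<in> carrier_mat n n" and B: "B \<in> carrier_mat n n"
    and ij: "i < n" "j < n" and q: "q < n"
    and zero: "\<And>k. k < n \<Longrightarrow> k \<noteq> q \<Longrightarrow> A $$ (i, k) = 0"
  shows "(A * B) $$ (i, j) = A $$ (i, q) * B $$ (q, j)"
proof -
  have "(A * B) $$ (i, j) = (\<Sum>k \<in> {0..<n}. A $$ (i, k) * B $$ (k, j))"
    using A B ij by (simp add: scalar_prod_def)
  also have "\<dots> = (\<Sum>k \<in> {q}. A $$ (i, k) * B $$ (k, j))"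
    by (rule sum.mono_neutral_right) (use q zero in auto)
  finally show ?thesis by simp
qed

lemma index_mult_mat_single_col_entry:
  fixes A B :: "'a :: semiring_0 mat"
  assumes A: "A \<in> carrier_mat n n" and B: "B \<in> carrier_mat n n"
    and ij: "i < n" "j < n" and p: "p < n"
    and zero: "\<And>k. k < n \<Longrightarrow> k \<noteq> p \<Longrightarrow> B $$ (k, j) = 0"
  shows "(A * B) $$ (i, j) = A $$ (i, p) * B $$ (p, j)"
proof -
  have "(A * B) $$ (i, j) = (\<Sum>k \<in> {0..<n}. A $$ (i, k) * B $$ (k, j))"
    using A B ij by (simp add: scalar_prod_def)
  also have "\<dots> = (\<Sum>k \<in> {p}. A $$ (i, k) * B $$ (k, j))"
    by (rule sum.mono_neutral_right) (use p zero in auto)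
  finally show ?thesis by simp
qed

lemma one_mat_mult:
  fixes A :: "'a :: {ring, monoid_mult} mat"
  assumes A: "A \<in> carrier_mat n n"
  shows "1\<^sub>m n * A = A"
proof (rule eq_matI)
  fix i j assume "i < dim_row A" "j < dim_col A"
  then have ij: "i < n" "j < n" using A by auto
  show "(1\<^sub>m n * A) $$ (i, j) = A $$ (i, j)"
    by (subst index_mult_mat_single_row_entry[of _ n _ i j i]) (use A ij in auto)
qed (use A in auto)

lemma mult_one_mat:
  fixes A :: "'a :: {ring, monoid_mult} mat"
  assumes A: "A \<in> carrier_mat n n"
  shows "A * 1\<^sub>m n = A"
proof (rule eq_matI)
  fix i j assume "i < dim_row A" "j < dim_col A"
  then have ij: "i < n" "j < n" using A by auto
  show "(A * 1\<^sub>m n) $$ (i, j) = A $$ (i, j)"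
    by (subst index_mult_mat_single_col_entry[of _ n _ i j j]) (use A ij in auto)
qed (use A in auto)

section \<open>Matrices whose commutators are central\<close>

definition unit_mat :: "nat \<Rightarrow> nat \<Rightarrow> nat \<Rightarrow> 'a :: zero \<Rightarrow> 'a mat" where
  "unit_mat n p q r = mat n n (\<lambda>(i, j). if i = p \<and> j = q then r else 0)"

lemma unit_mat_carrier [simp]: "unit_mat n p q r \<in> carrier_mat n n"
  by (simp add: unit_mat_def)

lemma unit_mat_dim [simp]: "dim_row (unit_mat n p q r) = n" "dim_col (unit_mat n p q r) = n"
  by (simp_all add: unit_mat_def)

lemma unit_mat_index:
  "i < n \<Longrightarrow> j < n \<Longrightarrow> unit_mat n p q r $$ (i, j) = (if i = p \<and> j = q then r else 0)"
  by (simp add: unit_mat_def)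

lemma unit_mat_mult_index:
  fixes A :: "'a :: semiring_0 mat"
  assumes "A \<in> carrier_mat n n" "i < n" "j < n" "q < n"
  shows "(unit_mat n p q r * A) $$ (i, j) = (if i = p then r * A $$ (q, j) else 0)"
  by (subst index_mult_mat_single_row_entry[of _ n _ i j q])
    (use assms in \<open>auto simp: unit_mat_index\<close>)

lemma mult_unit_mat_index:
  fixes A :: "'a :: semiring_0 mat"
  assumes "A \<in> carrier_mat n n" "i < n" "j < n" "p < n"
  shows "(A * unit_mat n p q r) $$ (i, j) = (if j = q then A $$ (i, p) * r else 0)"
  by (subst index_mult_mat_single_col_entry[of _ n _ i j p])
    (use assms in \<open>auto simp: unit_mat_index\<close>)

text \<open>
  Row \<open>p\<close> of \<open>E\<^sub>p\<^sub>p z\<close> is row \<open>p\<close> of \<open>z\<close>, while row \<open>p\<close> of \<open>z E\<^sub>p\<^sub>p\<close> is supported on the diagonal.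
\<close>

lemma mat_centre_off_diagonal_zero:
  fixes z :: "'a :: {ring, monoid_mult} mat"
  assumes z: "z \<in> mat_centre n" and ij: "p < n" "j < n" "p \<noteq> j"
  shows "z $$ (p, j) = 0"
proof -
  have zc: "z \<in> carrier_mat n n" using z by (simp add: mat_centre_def)
  have "z * unit_mat n p p 1 = unit_mat n p p 1 * z"
    using z by (simp add: mat_centre_def)
  then have "(z * unit_mat n p p 1) $$ (p, j) = (unit_mat n p p 1 * z) $$ (p, j)"
    by simp
  then show ?thesis
    using zc ij by (simp del: index_mult_mat(1) add: unit_mat_mult_index mult_unit_mat_index)
qed

text \<open>
  The off-diagonal entries of \<open>[E\<^sub>i\<^sub>i, c]\<close> are, up to sign, those of row and column \<open>i\<close> of \<open>c\<close>,
  so \<open>c\<close> is diagonal; the \<open>(p, q)\<close> entry of \<open>[rE\<^sub>p\<^sub>q, c]\<close> relates two diagonal entries of \<open>c\<close>.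
  Size at least two is essential: for \<open>n = 1\<close> the conclusion fails over the ring of upper
  triangular \<open>3 \<times> 3\<close> matrices over a field with constant diagonal, which is noncommutative although
  all its commutators are central.
\<close>

lemma central_if_commutators_central:
  fixes c :: "'a :: {ring, monoid_mult} mat"
  assumes n: "n \<ge> 2" and c: "c \<in> carrier_mat n n"
    and comm: "\<And>a. a \<in> carrier_mat n n \<Longrightarrow> a * c - c * a \<in> mat_centre n"
  shows "c \<in> mat_centre n"
proof -
  have off_diagonal:
    "(unit_mat n p q r * c - c * unit_mat n p q r) $$ (i, j) = 0"
    if "i < n" "j < n" "i \<noteq> j" for p q r i j
    by (rule mat_centre_off_diagonal_zero[OF comm[OF unit_mat_carrier] that])
  have diagonal: "c $$ (i, j) = 0" if ij: "i < n" "j < n" "i \<noteq> j" for i j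
    using off_diagonal[OF ij, of i i 1] ij c
    by (simp del: index_mult_mat(1) add: unit_mat_mult_index mult_unit_mat_index)
  have swap: "r * c $$ (q, q) = c $$ (p, p) * r" if pq: "p < n" "q < n" "p \<noteq> q" for p q r
    using off_diagonal[OF pq, of p q r] pq c
    by (simp del: index_mult_mat(1) add: unit_mat_mult_index mult_unit_mat_index)
  have swap_all: "r * c $$ (j, j) = c $$ (i, i) * r" if ij: "i < n" "j < n" for i j r
  proof (cases "i = j")
    case True
    \<comment> \<open>A second index \<open>q\<close> carries the same diagonal entry, by \<open>r = 1\<close>.\<close>
    obtain q where q: "q < n" "q \<noteq> i"
    proof (cases "i = 0")
      case True
      show ?thesis by (rule that[of 1]) (use n True in auto)
    next
      case False
      show ?thesis by (rule that[of 0]) (use n False in auto)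
    qed
    have "c $$ (q, q) = c $$ (i, i)"
      using swap[of i q 1] ij q by simp
    moreover have "r * c $$ (q, q) = c $$ (i, i) * r"
      using swap[of i q r] ij q by simp
    ultimately show ?thesis using True by simp
  next
    case False
    then show ?thesis using swap ij by simp
  qed
  have "c * a = a * c" if a: "a \<in> carrier_mat n n" for a
  proof (rule eq_matI)
    fix i j assume "i < dim_row (a * c)" "j < dim_col (a * c)"
    then have ij: "i < n" "j < n" using a c by auto
    have "(c * a) $$ (i, j) = c $$ (i, i) * a $$ (i, j)"
      by (rule index_mult_mat_single_row_entry) (use a c ij diagonal in auto)
    moreover have "(a * c) $$ (i, j) = a $$ (i, j) * c $$ (j, j)"
      by (rule index_mult_mat_single_col_entry) (use a c ij diagonal in auto)
    ultimately show "(c * a) $$ (i, j) = (a * c) $$ (i, j)"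
      using swap_all[OF ij] by simp
  qed (use a c in auto)
  with c show ?thesis by (simp add: mat_centre_def)
qed

section \<open>Jordan centralisers of matrix rings\<close>

text \<open>
  After the hypothesis is expanded, the summands \<open>abc\<close> and \<open>cba\<close> cancel and
  \<open>bac + cab = acb + bca\<close> is left.
\<close>

lemma commutator_central_if_jordan_centraliser:
  fixes a b c :: "'a :: ring mat"
  assumes a: "a \<in> carrier_mat n n" and b: "b \<in> carrier_mat n n" and c: "c \<in> carrier_mat n n"
    and eq: "(a * b + b * a) * c + c * (a * b + b * a) = a * (b * c + c * b) + (b * c + c * b) * a"
  shows "(a * c - c * a) * b = b * (a * c - c * a)"
proof (rule eq_matI)
  note dims = a b c
  note carr = mult_carrier_mat[of _ n n _ n]
  fix i j assume "i < dim_row (b * (a * c - c * a))" "j < dim_col (b * (a * c - c * a))"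
  then have ij: "i < n" "j < n" using dims by auto
  have lhs: "(a * b + b * a) * c + c * (a * b + b * a)
      = (a * (b * c) + b * (a * c)) + (c * (a * b) + c * (b * a))"
    using dims
    by (simp add: add_mult_distrib_mat[of _ n n _ _ n] mult_add_distrib_mat[of _ n n _ n] carr
        assoc_mult_mat[of _ n n _ n _ n])
  have rhs: "a * (b * c + c * b) + (b * c + c * b) * a
      = (a * (b * c) + a * (c * b)) + (b * (c * a) + c * (b * a))"
    using dims
    by (simp add: add_mult_distrib_mat[of _ n n _ _ n] mult_add_distrib_mat[of _ n n _ n] carr
        assoc_mult_mat[of _ n n _ n _ n])
  have "((a * (b * c) + b * (a * c)) + (c * (a * b) + c * (b * a))) $$ (i, j)
      = ((a * (b * c) + a * (c * b)) + (b * (c * a) + c * (b * a))) $$ (i, j)"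
    by (rule arg_cong[OF eq[unfolded lhs rhs]])
  then have key: "(b * (a * c)) $$ (i, j) + (c * (a * b)) $$ (i, j)
      = (a * (c * b)) $$ (i, j) + (b * (c * a)) $$ (i, j)"
    using dims ij by (simp del: index_mult_mat(1) add: algebra_simps)
  have "(a * c - c * a) * b = a * (c * b) - c * (a * b)"
    using dims
    by (simp add: minus_mult_distrib_mat[of _ n n _ _ n] carr assoc_mult_mat[of _ n n _ n _ n])
  moreover have "b * (a * c - c * a) = b * (a * c) - b * (c * a)"
    using dims by (simp add: mult_minus_distrib_mat[of _ n n _ n] carr)
  ultimately show "((a * c - c * a) * b) $$ (i, j) = (b * (a * c - c * a)) $$ (i, j)"
    using key dims ij by (simp del: index_mult_mat(1) add: algebra_simps)
qed (use a b c in auto)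

lemma mat_double_cancel:
  fixes A B :: "'a :: {ring, monoid_mult} mat"
  assumes tf: "two_torsion_free TYPE('a)"
    and A: "A \<in> carrier_mat n n" and B: "B \<in> carrier_mat n n" and eq: "A + A = B + B"
  shows "A = B"
proof (rule eq_matI)
  fix i j assume "i < dim_row B" "j < dim_col B"
  then have ij: "i < n" "j < n" using B by auto
  have "(A + A) $$ (i, j) = (B + B) $$ (i, j)" using eq by simp
  then have "(A $$ (i, j) - B $$ (i, j)) + (A $$ (i, j) - B $$ (i, j)) = 0"
    using A B ij by (simp add: algebra_simps)
  then have "A $$ (i, j) - B $$ (i, j) = 0"
    using tf unfolding two_torsion_free_def by blast
  then show "A $$ (i, j) = B $$ (i, j)" by simp
qed (use A B in auto)

theorem theorem4p2:
  fixes n :: nat and \<phi> :: "'a :: {ring, monoid_mult} mat \<Rightarrow> 'a mat"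
  assumes "two_torsion_free TYPE('a)"
    and "n \<ge> 2"
    and "\<phi> \<in> carrier_mat n n \<rightarrow> carrier_mat n n"
    and "\<And>a b. a \<in> carrier_mat n n \<Longrightarrow> b \<in> carrier_mat n n \<Longrightarrow> \<phi> (a + b) = \<phi> a + \<phi> b"
    and "\<And>a b. a \<in> carrier_mat n n \<Longrightarrow> b \<in> carrier_mat n n \<Longrightarrow>
           \<phi> (a * b + b * a) = a * \<phi> b + \<phi> b * a"
  shows "(\<forall>a \<in> carrier_mat n n. \<phi> a = a * \<phi> (1\<^sub>m n)) \<and> \<phi> (1\<^sub>m n) \<in> mat_centre n"
proof -
  note additive = assms(4) and jordan = assms(5)
  define c where "c = \<phi> (1\<^sub>m n)"
  have \<phi>_carrier: "\<phi> a \<in> carrier_mat n n" if "a \<in> carrier_mat n n" for a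
    using assms(3) that by auto
  have c: "c \<in> carrier_mat n n"
    unfolding c_def by (rule \<phi>_carrier) simp
  have double: "\<phi> a + \<phi> a = a * c + c * a" if a: "a \<in> carrier_mat n n" for a
    using jordan[OF a, of "1\<^sub>m n"] additive[OF a a] a
    by (simp add: c_def one_mat_mult mult_one_mat)
  have "c \<in> mat_centre n"
  proof (rule central_if_commutators_central[OF assms(2) c])
    fix a :: "'a mat" assume a: "a \<in> carrier_mat n n"
    have "(a * c - c * a) * b = b * (a * c - c * a)" if b: "b \<in> carrier_mat n n" for b
    proof (rule commutator_central_if_jordan_centraliser[OF a b c])
      have ab: "a * b + b * a \<in> carrier_mat n n" using a b by simp
      note \<phi>b = \<phi>_carrier[OF b]
      have "(a * b + b * a) * c + c * (a * b + b * a)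
          = (a * \<phi> b + \<phi> b * a) + (a * \<phi> b + \<phi> b * a)"
        by (rule double[OF ab, unfolded jordan[OF a b], symmetric])
      also have "\<dots> = (a * \<phi> b + a * \<phi> b) + (\<phi> b * a + \<phi> b * a)"
        by (rule eq_matI) (use a \<phi>b in \<open>auto simp del: index_mult_mat(1) simp: algebra_simps\<close>)
      also have "\<dots> = a * (\<phi> b + \<phi> b) + (\<phi> b + \<phi> b) * a"
        using a \<phi>b
        by (simp add: add_mult_distrib_mat[of _ n n _ _ n] mult_add_distrib_mat[of _ n n _ n])
      also have "\<dots> = a * (b * c + c * b) + (b * c + c * b) * a"
        using double[OF b] by simp
      finally show "(a * b + b * a) * c + c * (a * b + b * a)
          = a * (b * c + c * b) + (b * c + c * b) * a" .
    qed
    then show "a * c - c * a \<in> mat_centre n"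
      using a c by (auto simp: mat_centre_def)
  qed
  moreover have "\<phi> a = a * c" if a: "a \<in> carrier_mat n n" for a
  proof (rule mat_double_cancel[OF assms(1) \<phi>_carrier[OF a]])
    have "c * a = a * c"
      using \<open>c \<in> mat_centre n\<close> a by (simp add: mat_centre_def)
    then show "\<phi> a + \<phi> a = a * c + a * c" using double[OF a] by simp
  qed (use a c in simp)
  ultimately show ?thesis unfolding c_def by blast
qed

end
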